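(* An FSA $\mathcal{S}$ is not strongly periodically detectable if and only if in its detector $\mathcal{S}_{det}$ at least one of the two following conditions holds. (i) There is a reachable state $q'\in Q$ of $\mathcal{S}_{det}$ and $x\in q'$ such that $|q'|>1$ and there is a transition sequence $x\xrightarrow{s_1}x'\xrightarrow{s_2}x'$ in $\mathcal{S}$ for some $s_1\in(T_{uo})^*$, $s_2\in(T_{uo})^+$, $x'\in X$. (ii) There is a reachable transition cycle in $\mathcal{S}_{det}$ such that all states in the cycle have cardinality $2$.
   Context: The symbol $\subset$ denotes the (not necessarily proper) subset relation. For a finite alphabet $A$, $A^*$ and $A^\omega$ denote the sets of finite words (including the empty word $\epsilon$) and of infinite sequences over $A$, and $A^+=A^*\setminus\{\epsilon\}$. For $s\in A^*\cup A^\omega$, $s'\sqsubset s$ means that $s'\in A^*$ is a (not necessarily proper) prefix of $s$. $|s|$ is the length of a word $s$; $|S|$ is the cardinality of a set $S$, and $2^S$ its power set. A finite-state automaton (FSA) is a sextuple $\mathcal{S}=(X,T,X_0,\delta,\Sigma,\ell)$, where $X$ is a finite set of states, $T$ a finite set of events, $X_0\subset X$ a set of initial states, $\delta\subset X\times T\times X$ a transition relation, $\Sigma$ a finite set of outputs (labels), and $\ell:T\to\Sigma\cup\{\epsilon\}$ a labeling function, extended to $\ell:T^*\cup T^\omega\to\Sigma^*\cup\Sigma^\omega$ by $\ell(t_1t_2\dots)=\ell(t_1)\ell(t_2)\dots$, $\ell(\epsilon)=\epsilon$ (a sequence in $T^\omega$ may have a finite label sequence). $T_{uo}=\{t\in T:\ell(t)=\epsilon\}$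 is the set of unobservable events. $\delta$ is extended to $\delta\subset X\times T^*\times X$ in the usual way; $x\xrightarrow{s}x'$ means $(x,s,x')\in\delta$. $L^\omega(\mathcal{S})=\{t_1t_2\dots\in T^\omega : \exists x_0\in X_0,\ \exists x_1,x_2,\dots\in X,\ x_0\xrightarrow{t_1}x_1\xrightarrow{t_2}\cdots\}$. For $\sigma\in\Sigma^*$, the current-state estimate is $\mathcal{M}(\mathcal{S},\sigma)=\{x\in X : \exists x_0\in X_0,\ \exists s\in T^*,\ \ell(s)=\sigma \text{ and } x_0\xrightarrow{s}x\}$. $\mathcal{S}$ is strongly periodically detectable if there exists a positive integer $k$ such that for each $s\in L^\omega(\mathcal{S})$ and each finite prefix $s'\sqsubset s$, there is $s''\in T^*$ such that $|\ell(s'')|<k$, $s's''\sqsubset s$, and $|\mathcal{M}(\mathcal{S},\ell(s's''))|=1$. For $x\in X$, the unobservable reach is $\mathrm{UR}(x)=\{x'\in X:\exists s\in(T_{uo})^*,\ (x,s,x')\in\delta\}$, and for $\sigma\in\Sigma$ the observable reach is $\mathrm{Reach}_\sigma(x)=\{x'\in X:\exists t\in T,\ (x,t,x')\in\delta,\ \ell(t)=\sigma\}$. For $X'\subset X$, $\mathrm{UR}(X')=\bigcup_{x\in X'}\mathrm{UR}(x)$ and $\mathrm{Reach}_\sigma(X')=\bigcup_{x\in X'}\mathrm{Reach}_\sigma(x)$. The detector $\mathcal{S}_{det}=(Q,\Sigma,\mathcal{M}(\mathcal{S},\epsilon),\delta_{det})$ is the nondeterministic automaton with initial state $\mathcal{M}(\mathcal{S},\epsilon)$,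 where $Q\subset 2^X\setminus\{\emptyset\}$ consists of $\mathcal{M}(\mathcal{S},\epsilon)$ and the nonempty subsets of $X$ of cardinality $\le 2$; for all $q,q'\in Q$ and $\sigma\in\Sigma$, $(q,\sigma,q')\in\delta_{det}$ if and only if either (1) $|\mathrm{UR}(\mathrm{Reach}_\sigma(q))|>1$, $q'\subset\mathrm{UR}(\mathrm{Reach}_\sigma(q))$, and $|q'|=2$, or (2) $|\mathrm{UR}(\mathrm{Reach}_\sigma(q))|=1$ and $q'=\mathrm{UR}(\mathrm{Reach}_\sigma(q))$. In an automaton, a state is reachable if it is initial or can be reached from an initial state by a transition sequence. A transition cycle is a transition sequence of positive length from a state to itself; the states of the cycle are all states visited along it; it is reachable if its states are reachable. *)

theory Defs
  imports "HOL-Library.Stream"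
begin

text \<open>The underlying labelled transition structure is shared by finite-state automata and
  their detectors; finiteness and well-formedness are imposed separately below.\<close>

record ('q, 'e) automaton =
  states :: "'q set"
  events :: "'e set"
  init :: "'q set"
  delta :: "('q \<times> 'e \<times> 'q) set"

inductive steps :: "('q, 'e, 'z) automaton_scheme \<Rightarrow> 'q \<Rightarrow> 'e list \<Rightarrow> 'q \<Rightarrow> bool"
  for A :: "('q, 'e, 'z) automaton_scheme" where
  Nil: "x \<in> states A \<Longrightarrow> steps A x [] x"
| Cons: "(x, t, y) \<in> delta A \<Longrightarrow> steps A y s z \<Longrightarrow> steps A x (t # s) z"

definition reachable :: "('q, 'e, 'z) automaton_scheme \<Rightarrow> 'q \<Rightarrow> bool" where
  "reachable A q \<longleftrightarrow> (\<exists>q0\<in>init A. \<exists>es\<in>lists (events A). steps A q0 es q)"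

text \<open>A transition sequence is given by the list \<open>qs\<close> of all states it visits (first and last
  state included) and the list \<open>es\<close> of its events.\<close>

definition transition_sequence ::
  "('q, 'e, 'z) automaton_scheme \<Rightarrow> 'q list \<Rightarrow> 'e list \<Rightarrow> bool" where
  "transition_sequence A qs es \<longleftrightarrow>
     set qs \<subseteq> states A \<and> length qs = Suc (length es) \<and>
     (\<forall>i<length es. (qs ! i, es ! i, qs ! Suc i) \<in> delta A)"

definition transition_cycle ::
  "('q, 'e, 'z) automaton_scheme \<Rightarrow> 'q list \<Rightarrow> 'e list \<Rightarrow> bool" where
  "transition_cycle A qs es \<longleftrightarrow>
     transition_sequence A qs es \<and> es \<noteq> [] \<and> hd qs = last qs"

definition reachable_cycle ::
  "('q, 'e, 'z) automaton_scheme \<Rightarrow> 'q list \<Rightarrow> 'e list \<Rightarrow> bool" where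
  "reachable_cycle A qs es \<longleftrightarrow>
     transition_cycle A qs es \<and> (\<forall>q\<in>set qs. reachable A q)"

text \<open>A label \<open>None\<close> stands for the empty word \<open>\<epsilon>\<close>.\<close>

record ('x, 't, 'a) fsa = "('x, 't) automaton" +
  outputs :: "'a set"
  label :: "'t \<Rightarrow> 'a option"

locale finite_state_automaton =
  fixes S :: "('x, 't, 'a) fsa"
  assumes finite_states: "finite (states S)"
    and finite_events: "finite (events S)"
    and init_subset: "init S \<subseteq> states S"
    and delta_subset: "delta S \<subseteq> states S \<times> events S \<times> states S"
    and finite_outputs: "finite (outputs S)"
    and label_range: "label S ` events S \<subseteq> insert None (Some ` outputs S)"

definition label_word :: "('x, 't, 'a) fsa \<Rightarrow> 't list \<Rightarrow> 'a list" where
  "label_word S s = List.map_filter (label S) s"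

definition unobservable :: "('x, 't, 'a) fsa \<Rightarrow> 't set" where
  "unobservable S = {t \<in> events S. label S t = None}"

definition omega_language :: "('x, 't, 'a) fsa \<Rightarrow> 't stream set" where
  "omega_language S =
     {s \<in> streams (events S). \<exists>xs \<in> streams (states S).
        shd xs \<in> init S \<and> (\<forall>i. (xs !! i, s !! i, xs !! Suc i) \<in> delta S)}"

definition finite_prefix :: "'t list \<Rightarrow> 't stream \<Rightarrow> bool" where
  "finite_prefix u s \<longleftrightarrow> (\<exists>r. s = u @- r)"

definition estimate :: "('x, 't, 'a) fsa \<Rightarrow> 'a list \<Rightarrow> 'x set" where
  "estimate S \<sigma> =
     {x \<in> states S. \<exists>x0\<in>init S. \<exists>s\<in>lists (events S). label_word S s = \<sigma> \<and> steps S x0 s x}"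

definition strongly_periodically_detectable :: "('x, 't, 'a) fsa \<Rightarrow> bool" where
  "strongly_periodically_detectable S \<longleftrightarrow>
     (\<exists>k>0. \<forall>s\<in>omega_language S. \<forall>s'. finite_prefix s' s \<longrightarrow>
        (\<exists>s''\<in>lists (events S).
           length (label_word S s'') < k \<and> finite_prefix (s' @ s'') s \<and>
           card (estimate S (label_word S (s' @ s''))) = 1))"

definition unobs_reach :: "('x, 't, 'a) fsa \<Rightarrow> 'x \<Rightarrow> 'x set" where
  "unobs_reach S x = {x' \<in> states S. \<exists>s\<in>lists (unobservable S). steps S x s x'}"

definition obs_reach :: "('x, 't, 'a) fsa \<Rightarrow> 'a \<Rightarrow> 'x \<Rightarrow> 'x set" where
  "obs_reach S \<sigma> x =
     {x' \<in> states S. \<exists>t\<in>events S. (x, t, x') \<in> delta S \<and> label S t = Some \<sigma>}"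

definition UR :: "('x, 't, 'a) fsa \<Rightarrow> 'x set \<Rightarrow> 'x set" where
  "UR S X' = (\<Union>x\<in>X'. unobs_reach S x)"

definition Reach :: "('x, 't, 'a) fsa \<Rightarrow> 'a \<Rightarrow> 'x set \<Rightarrow> 'x set" where
  "Reach S \<sigma> X' = (\<Union>x\<in>X'. obs_reach S \<sigma> x)"

text \<open>If there are no initial states, then \<open>estimate S []\<close> is empty; it is nevertheless kept
  as the (then isolated) initial state of the detector.\<close>

definition detector_states :: "('x, 't, 'a) fsa \<Rightarrow> 'x set set" where
  "detector_states S =
     insert (estimate S []) {q. q \<subseteq> states S \<and> q \<noteq> {} \<and> card q \<le> 2}"

definition detector :: "('x, 't, 'a) fsa \<Rightarrow> ('x set, 'a) automaton" where
  "detector S =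
     \<lparr> states = detector_states S,
       events = outputs S,
       init = {estimate S []},
       delta = {(q, \<sigma>, q'). q \<in> detector_states S \<and> \<sigma> \<in> outputs S \<and> q' \<in> detector_states S \<and>
         (card (UR S (Reach S \<sigma> q)) > 1 \<and> q' \<subseteq> UR S (Reach S \<sigma> q) \<and> card q' = 2 \<or>
          card (UR S (Reach S \<sigma> q)) = 1 \<and> q' = UR S (Reach S \<sigma> q))} \<rparr>"

end

theory Submission
  imports Defs
begin

text \<open>The current-state estimate satisfies \<open>M(\<sigma>a) = UR(Reach\<^sub>a(M(\<sigma>)))\<close>, so every detector state
  reached by \<open>\<sigma>\<close> is contained in \<open>M(\<sigma>)\<close>. Conversely, every subset of \<open>M(\<sigma>)\<close> of the right
  cardinality is reached by \<open>\<sigma>\<close>: backwards along \<open>\<sigma>\<close>, at most two states have at most two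
  predecessors. If detectability fails for a bound exceeding the number of two-element sets, then
  the estimate stays ambiguous either during an infinite unobservable suffix, which repeats a state,
  or during more observations than there are two-element sets, in which case a backward path of
  two-element detector states repeats. For the other direction, either condition yields an infinite
  word \<open>u v\<^sup>\<omega>\<close> that stays ambiguous from \<open>u\<close> on. For a detector cycle, the loop \<open>v\<close> exists because
  every state in a set of the cycle has a predecessor in the same set one turn earlier, and the set
  is finite.\<close>

section \<open>Words and transitions\<close>

lemma steps_append: "steps A x u y \<Longrightarrow> steps A y v z \<Longrightarrow> steps A x (u @ v) z"
  by (induction rule: steps.induct) (auto intro: steps.Cons)

lemma steps_Nil_iff: "steps A x [] y \<longleftrightarrow> x = y \<and> x \<in> states A"
  by (auto intro: steps.Nil elim: steps.cases)

lemma steps_Cons_iff: "steps A x (t # u) z \<longleftrightarrow> (\<exists>y. (x, t, y) \<in> delta A \<and> steps A y u z)"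
  by (auto intro: steps.Cons elim: steps.cases)

lemma steps_target_in_states: "steps A x u y \<Longrightarrow> y \<in> states A"
  by (induction rule: steps.induct) auto

lemma reachable_step:
  assumes "reachable A q" "(q, e, q') \<in> delta A" "e \<in> events A" "q' \<in> states A"
  shows "reachable A q'"
proof -
  from assms(1) obtain q0 es where "q0 \<in> init A" "es \<in> lists (events A)" "steps A q0 es q"
    unfolding reachable_def by blast
  moreover have "steps A q [e] q'"
    using assms by (auto intro: steps.intros)
  ultimately show ?thesis
    unfolding reachable_def using assms(3) by (intro bexI[of _ q0] bexI[of _ "es @ [e]"])
      (auto intro: steps_append)
qed

lemma transition_sequence_steps:
  "transition_sequence A qs es \<Longrightarrow> i \<le> length es \<Longrightarrow> steps A (qs ! 0) (take i es) (qs ! i)"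
proof (induction i)
  case 0
  then have "qs ! 0 \<in> states A"
    unfolding transition_sequence_def by (metis nth_mem subsetD zero_less_Suc)
  then show ?case by (simp add: steps_Nil_iff)
next
  case (Suc i)
  then have "(qs ! i, es ! i, qs ! Suc i) \<in> delta A" "qs ! Suc i \<in> states A"
    unfolding transition_sequence_def by (auto simp: subset_iff)
  then have "steps A (qs ! i) [es ! i] (qs ! Suc i)"
    by (simp add: steps_Cons_iff steps_Nil_iff)
  with Suc show ?case
    by (simp add: take_Suc_conv_app_nth steps_append)
qed

lemma transition_sequence_infix:
  assumes "transition_sequence A qs es" "i \<le> j" "j \<le> length es"
  shows "transition_sequence A (take (Suc (j - i)) (drop i qs)) (take (j - i) (drop i es))"
  using assms set_take_subset[of "Suc (j - i)" "drop i qs"] set_drop_subset[of i qs]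
  unfolding transition_sequence_def by auto

section \<open>Label sequences and their factorizations\<close>

lemma label_word_append [simp]: "label_word S (u @ v) = label_word S u @ label_word S v"
  by (induction u) (auto simp: label_word_def List.map_filter_simps split: option.splits)

lemma label_word_Nil [simp]: "label_word S [] = []"
  by (simp add: label_word_def List.map_filter_simps)

lemma label_word_Cons [simp]:
  "label_word S (t # u) = (case label S t of None \<Rightarrow> [] | Some a \<Rightarrow> [a]) @ label_word S u"
  by (simp add: label_word_def List.map_filter_simps split: option.splits)

lemma label_word_eq_Nil_iff: "label_word S u = [] \<longleftrightarrow> (\<forall>t\<in>set u. label S t = None)"
  by (induction u) (auto split: option.splits)

text \<open>Since unobservable events are erased, a cut of the label sequence must be pulled back to
  some cut of the event word. In the induction an empty \<open>v\<close> takes the empty prefix;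
  otherwise the first event goes left, because its label, if any, is the head of
  \<open>v\<close>.\<close>

lemma label_word_eq_appendE:
  assumes "label_word S u = v @ w"
  obtains u1 u2 where "u = u1 @ u2" "label_word S u1 = v" "label_word S u2 = w"
  using assms
proof (induction u arbitrary: v thesis)
  case Nil
  then show ?case by simp
next
  case (Cons t u)
  show ?case
  proof (cases "v = []")
    case True
    then show ?thesis using Cons.prems(1)[of "[]" "t # u"] Cons.prems(2) by simp
  next
    case False
    then obtain v' where "label_word S u = v' @ w"
      "v = (case label S t of None \<Rightarrow> [] | Some a \<Rightarrow> [a]) @ v'"
      using Cons.prems(2) by (cases v) (auto split: option.splits)
    then show ?thesis using Cons.IH[of v'] Cons.prems(1) by (metis append_Cons label_word_Cons)
  qed
qed

lemma label_word_eq_singletonE: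
  assumes "label_word S u = [a]"
  obtains u1 t u2 where "u = u1 @ t # u2" "label_word S u1 = []" "label S t = Some a"
    "label_word S u2 = []"
  using assms
proof (induction u arbitrary: thesis)
  case Nil
  then show ?case by simp
next
  case (Cons t u)
  show ?case
  proof (cases "label S t")
    case None
    then show ?thesis using Cons.IH Cons.prems
      by simp (metis None append_Cons label_word_Cons option.simps(4) append_Nil)
  next
    case (Some b)
    then show ?thesis using Cons.prems(1)[of "[]" t u] Cons.prems(2) by simp
  qed
qed

lemma concat_replicate_snoc: "concat (replicate n v) @ v = concat (replicate (Suc n) v)"
  by (induction n) auto

text \<open>Division with remainder writes \<open>w\<close> as full copies of \<open>v\<close> plus
  a partial one; the rest of that copy serves as \<open>w'\<close>. This reduces prefixes of the
  infinite loop to prefixes of finite powers, where induction applies.\<close>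

lemma prefix_of_cycle:
  assumes "v \<noteq> []" "w @- r = cycle v"
  shows "\<exists>n w'. w @ w' = concat (replicate n v)"
proof -
  let ?d = "length w div length v" and ?m = "length w mod length v"
  have "w = stake (length w) (cycle v)"
    unfolding assms(2)[symmetric] by (simp add: stake_shift)
  also have "\<dots> = concat (replicate ?d v) @ take ?m v"
    using assms(1) by (rule stake_cycle)
  finally have "w @ drop ?m v = concat (replicate (Suc ?d) v)"
    by (metis append.assoc append_take_drop_id concat_replicate_snoc)
  then show ?thesis by blast
qed

section \<open>Reach operators and detector transitions\<close>

lemma UR_mono: "X \<subseteq> Y \<Longrightarrow> UR S X \<subseteq> UR S Y"
  unfolding UR_def by blast

lemma Reach_mono: "X \<subseteq> Y \<Longrightarrow> Reach S a X \<subseteq> Reach S a Y"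
  unfolding Reach_def by blast

text \<open>Both operators are unions over source states, so a single predecessor accounts for each
  target state. This keeps sets small when going backwards.\<close>

lemma mem_UR_Reach_pointwise:
  "y \<in> UR S (Reach S a X) \<longleftrightarrow> (\<exists>x\<in>X. y \<in> UR S (Reach S a {x}))"
  by (auto simp: UR_def Reach_def)

lemma detector_simps [simp]:
  "states (detector S) = detector_states S"
  "events (detector S) = outputs S"
  "init (detector S) = {estimate S []}"
  by (simp_all add: detector_def)

lemma detector_delta_iff:
  "(q, a, q') \<in> delta (detector S) \<longleftrightarrow>
    q \<in> detector_states S \<and> a \<in> outputs S \<and> q' \<in> detector_states S \<and>
    (card (UR S (Reach S a q)) > 1 \<and> q' \<subseteq> UR S (Reach S a q) \<and> card q' = 2 \<or>
     card (UR S (Reach S a q)) = 1 \<and> q' = UR S (Reach S a q))"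
  by (simp add: detector_def)

lemma detector_delta_subset: "(q, a, q') \<in> delta (detector S) \<Longrightarrow> q' \<subseteq> UR S (Reach S a q)"
  by (auto simp: detector_delta_iff)

text \<open>The sets in which the detector may be after \<open>\<sigma>\<close> without losing
  ambiguity. The initial detector state is the whole estimate, whatever its size; afterwards
  \<open>min 2\<close> merges the two detector rules, a pair for an ambiguous estimate and the
  singleton otherwise.\<close>

definition detector_sample :: "('x, 't, 'a) fsa \<Rightarrow> 'a list \<Rightarrow> 'x set \<Rightarrow> bool" where
  "detector_sample S \<sigma> q \<longleftrightarrow> q \<noteq> {} \<and> q \<subseteq> estimate S \<sigma> \<and>
     (if \<sigma> = [] then q = estimate S [] else card q = min 2 (card (estimate S \<sigma>)))"

context finite_state_automaton
begin

section \<open>Runs of the automaton and the recursion for estimates\<close>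

lemma estimate_subset: "estimate S \<sigma> \<subseteq> states S"
  by (auto simp: estimate_def)

lemma finite_estimate: "finite (estimate S \<sigma>)"
  using estimate_subset finite_states finite_subset by blast

lemma steps_source_in_states: "steps S x u y \<Longrightarrow> x \<in> states S"
  by (erule steps.cases) (use delta_subset in auto)

lemma steps_events: "steps S x u y \<Longrightarrow> u \<in> lists (events S)"
  by (induction rule: steps.induct) (use delta_subset in auto)

lemma steps_append_iff: "steps S x (u @ v) z \<longleftrightarrow> (\<exists>y. steps S x u y \<and> steps S y v z)"
proof (induction u arbitrary: x)
  case Nil
  then show ?case using steps_source_in_states by (auto simp: steps_Nil_iff)
qed (auto simp: steps_Cons_iff)

lemma label_word_outputs: "u \<in> lists (events S) \<Longrightarrow> label_word S u \<in> lists (outputs S)"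
proof (induction u)
  case (Cons t u)
  then show ?case using label_range by (auto split: option.splits)
qed simp

lemma unobservable_word_iff:
  "u \<in> lists (unobservable S) \<longleftrightarrow> u \<in> lists (events S) \<and> label_word S u = []"
  by (auto simp: unobservable_def label_word_eq_Nil_iff)

lemma mem_estimate_iff:
  "x \<in> estimate S \<sigma> \<longleftrightarrow> (\<exists>x0\<in>init S. \<exists>u. label_word S u = \<sigma> \<and> steps S x0 u x)"
proof
  show "x \<in> estimate S \<sigma> \<Longrightarrow> \<exists>x0\<in>init S. \<exists>u. label_word S u = \<sigma> \<and> steps S x0 u x"
    unfolding estimate_def by blast
next
  assume "\<exists>x0\<in>init S. \<exists>u. label_word S u = \<sigma> \<and> steps S x0 u x"
  then obtain x0 u where u: "x0 \<in> init S" "label_word S u = \<sigma>" "steps S x0 u x" by blast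
  from u show "x \<in> estimate S \<sigma>"
    using steps_target_in_states[OF u(3)] steps_events[OF u(3)] unfolding estimate_def by blast
qed

lemma mem_UR_Reach_iff:
  "y \<in> UR S (Reach S a X) \<longleftrightarrow>
    (\<exists>x\<in>X. \<exists>t u. label S t = Some a \<and> label_word S u = [] \<and> steps S x (t # u) y)"
  (is "?l \<longleftrightarrow> ?r")
proof
  assume ?l
  then obtain x z where x: "x \<in> X" "z \<in> obs_reach S a x" "y \<in> unobs_reach S z"
    unfolding UR_def Reach_def by blast
  from x(2) obtain t where t: "(x, t, z) \<in> delta S" "label S t = Some a"
    unfolding obs_reach_def by blast
  from x(3) obtain u where "u \<in> lists (unobservable S)" "steps S z u y"
    unfolding unobs_reach_def by blast
  then have "label_word S u = []" "steps S x (t # u) y"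
    using t(1) by (auto simp only: unobservable_word_iff intro: steps.Cons)
  with x(1) t(2) show ?r by blast
next
  assume ?r
  then obtain x t u z where *: "x \<in> X" "label S t = Some a" "label_word S u = []"
    "(x, t, z) \<in> delta S" "steps S z u y"
    by (auto simp: steps_Cons_iff)
  have "z \<in> obs_reach S a x"
    using * delta_subset unfolding obs_reach_def by blast
  moreover have "u \<in> lists (unobservable S)"
    unfolding unobservable_word_iff using *(3) steps_events[OF *(5)] by blast
  then have "y \<in> unobs_reach S z"
    unfolding unobs_reach_def using steps_target_in_states[OF *(5)] *(5) by blast
  moreover note *
  ultimately show ?l
    unfolding UR_def Reach_def by blast
qed

lemma estimate_snoc: "estimate S (\<sigma> @ [a]) = UR S (Reach S a (estimate S \<sigma>))"
proof (intro set_eqI iffI)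
  fix y assume "y \<in> estimate S (\<sigma> @ [a])"
  then obtain x0 w where w: "x0 \<in> init S" "label_word S w = \<sigma> @ [a]" "steps S x0 w y"
    unfolding mem_estimate_iff by blast
  from w(2) obtain u v where uv: "w = u @ v" "label_word S u = \<sigma>" "label_word S v = [a]"
    by (rule label_word_eq_appendE)
  from uv(3) obtain v1 t v2 where v: "v = v1 @ t # v2" "label_word S v1 = []"
      "label S t = Some a" "label_word S v2 = []"
    by (rule label_word_eq_singletonE)
  \<comment> \<open>The silent word \<open>v1\<close> before the observable event is attached to
    \<open>u\<close>, which leaves the label \<open>\<sigma>\<close> unchanged: estimates are
    already closed under unobservable moves.\<close>
  obtain x where "steps S x0 (u @ v1) x" "steps S x (t # v2) y"
    using w(3) uv(1) v(1) steps_append_iff[of x0 "u @ v1" "t # v2" y] by auto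
  moreover have "label_word S (u @ v1) = \<sigma>" using uv v by simp
  ultimately show "y \<in> UR S (Reach S a (estimate S \<sigma>))"
    unfolding mem_UR_Reach_iff using w(1) v(3,4) mem_estimate_iff by blast
next
  fix y assume "y \<in> UR S (Reach S a (estimate S \<sigma>))"
  then obtain x t v where "x \<in> estimate S \<sigma>"
    "label S t = Some a" "label_word S v = []" "steps S x (t # v) y"
    unfolding mem_UR_Reach_iff by blast
  moreover from this obtain x0 u where "x0 \<in> init S" "label_word S u = \<sigma>" "steps S x0 u x"
    unfolding mem_estimate_iff by blast
  ultimately have "steps S x0 (u @ t # v) y" "label_word S (u @ t # v) = \<sigma> @ [a]" "x0 \<in> init S"
    by (simp_all add: steps_append)
  then show "y \<in> estimate S (\<sigma> @ [a])"
    unfolding mem_estimate_iff by blast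
qed

section \<open>Detector paths and current-state estimates\<close>

lemma detector_states_subset: "q \<in> detector_states S \<Longrightarrow> q \<subseteq> states S"
  using estimate_subset by (auto simp: detector_states_def)

lemma detector_steps_subset:
  "steps (detector S) q es q' \<Longrightarrow> q \<subseteq> estimate S \<sigma> \<Longrightarrow> q' \<subseteq> estimate S (\<sigma> @ es)"
proof (induction arbitrary: \<sigma> rule: steps.induct)
  case (Cons q a p es q')
  have "p \<subseteq> UR S (Reach S a q)" using Cons.hyps(1) by (rule detector_delta_subset)
  also have "\<dots> \<subseteq> estimate S (\<sigma> @ [a])"
    unfolding estimate_snoc using Cons.prems by (intro UR_mono Reach_mono)
  finally have "p \<subseteq> estimate S (\<sigma> @ [a])" .
  then show ?case using Cons.IH by fastforce
qed simp

lemma detector_reachable_subset: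
  assumes "reachable (detector S) q"
  obtains \<sigma> where "q \<subseteq> estimate S \<sigma>"
  using assms detector_steps_subset[of "estimate S []" _ q "[]"] unfolding reachable_def by auto

text \<open>Every detector transition only collects states reachable from its source set, so a run
  can be traced backwards from any chosen target. Forwards this may fail, as a state of
  \<open>q\<close> need not have a successor in \<open>q'\<close>.\<close>

lemma detector_steps_lift:
  "steps (detector S) q es q' \<Longrightarrow> y \<in> q' \<Longrightarrow> \<exists>x\<in>q. \<exists>u. steps S x u y \<and> label_word S u = es"
proof (induction rule: steps.induct)
  case (Nil q)
  then have "steps S y [] y"
    using detector_states_subset by (auto simp: steps_Nil_iff)
  then show ?case using Nil by force
next
  case (Cons q a p es q')
  then obtain z u where z: "z \<in> p" "steps S z u y" "label_word S u = es" by blast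
  then obtain x t v where "x \<in> q" "label S t = Some a" "label_word S v = []"
      "steps S x (t # v) z"
    using detector_delta_subset[OF Cons.hyps(1)] mem_UR_Reach_iff by blast
  moreover from this z have "steps S x ((t # v) @ u) y" "label_word S ((t # v) @ u) = a # es"
    by (blast intro: steps_append) (simp add: calculation z)
  with \<open>x \<in> q\<close> show ?case by blast
qed

lemma detector_sample_in_states: "detector_sample S \<sigma> q \<Longrightarrow> q \<in> detector_states S"
  using estimate_subset[of \<sigma>] unfolding detector_sample_def detector_states_def
  by (auto split: if_splits)

text \<open>The sample at \<open>\<sigma>\<close> is obtained by choosing one predecessor for each element of \<open>q\<close> and
  filling up to the prescribed cardinality.\<close>

lemma detector_sample_backtrack:
  assumes "detector_sample S (\<sigma> @ [a]) q" "a \<in> outputs S"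
  shows "\<exists>p. detector_sample S \<sigma> p \<and> (p, a, q) \<in> delta (detector S)"
proof -
  let ?M = "estimate S \<sigma>" and ?M' = "estimate S (\<sigma> @ [a])"
  have q: "q \<noteq> {}" "q \<subseteq> ?M'" "card q = min 2 (card ?M')"
    using assms(1) by (auto simp: detector_sample_def)
  have "finite q" using q(2) finite_estimate finite_subset by blast
  have "\<forall>y\<in>q. \<exists>x\<in>?M. y \<in> UR S (Reach S a {x})"
    using q(2) mem_UR_Reach_pointwise[of _ S a ?M] unfolding estimate_snoc by blast
  then obtain f where f: "\<And>y. y \<in> q \<Longrightarrow> f y \<in> ?M" "\<And>y. y \<in> q \<Longrightarrow> y \<in> UR S (Reach S a {f y})"
    by metis
  obtain p where p: "f ` q \<subseteq> p" "detector_sample S \<sigma> p"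
  proof (cases "\<sigma> = []")
    case True
    have "f ` q \<subseteq> ?M" using f(1) by blast
    moreover from this have "detector_sample S \<sigma> ?M"
      using True q(1) unfolding detector_sample_def by auto
    ultimately show ?thesis by (rule that)
  next
    case False
    have sub: "f ` q \<subseteq> ?M" using f(1) by blast
    \<comment> \<open>The image is no larger than \<open>q\<close>, which has at most two elements,
      so it fits into a set of the size prescribed at \<open>\<sigma>\<close>.\<close>
    have "card (f ` q) \<le> min 2 (card ?M)"
      using card_image_le[OF \<open>finite q\<close>, of f] card_mono[OF finite_estimate sub] q(3) by simp
    from exists_subset_between[OF this _ sub finite_estimate]
    obtain p where "f ` q \<subseteq> p" "p \<subseteq> ?M" "card p = min 2 (card ?M)" by auto
    then show ?thesis using that[of p] False q(1) unfolding detector_sample_def by auto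
  qed
  let ?W = "UR S (Reach S a p)"
  have "{f y} \<subseteq> p" if "y \<in> q" for y using p(1) that by blast
  then have qW: "q \<subseteq> ?W" using f(2) UR_mono Reach_mono by (meson subsetD subsetI)
  have "p \<subseteq> ?M" using p(2) by (simp add: detector_sample_def)
  then have WM: "?W \<subseteq> ?M'" unfolding estimate_snoc by (intro UR_mono Reach_mono)
  then have finW: "finite ?W" using finite_estimate finite_subset by blast
  have "card ?W \<noteq> 0" using qW q(1) finW by auto
  then consider "card ?W > 1" | "card ?W = 1" by linarith
  \<comment> \<open>Only the size of \<open>?W\<close> decides which detector rule applies. If
    \<open>?W\<close> is ambiguous, so is the larger \<open>?M'\<close>, whence \<open>q\<close> is
    a pair; if \<open>?W\<close> is a singleton, the nonempty \<open>q\<close> fills it.\<close>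
  then have "card ?W > 1 \<and> q \<subseteq> ?W \<and> card q = 2 \<or> card ?W = 1 \<and> q = ?W"
  proof cases
    case 1
    then have "card q = 2" using q(3) card_mono[OF finite_estimate WM] by simp
    with 1 qW show ?thesis by blast
  next
    case 2
    then have "q = ?W" using qW q(1) by (metis card_1_singletonE subset_singleton_iff)
    with 2 show ?thesis by blast
  qed
  then have "(p, a, q) \<in> delta (detector S)"
    unfolding detector_delta_iff
    using detector_sample_in_states[OF p(2)] detector_sample_in_states[OF assms(1)] assms(2)
    by blast
  with p(2) show ?thesis by blast
qed

text \<open>Backtracking through all of \<open>\<sigma>\<close> ends in a sample at the empty word,
  which is the initial detector state.\<close>

lemma detector_sample_reachable:
  "detector_sample S \<sigma> q \<Longrightarrow> \<sigma> \<in> lists (outputs S) \<Longrightarrow> reachable (detector S) q"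
proof (induction \<sigma> arbitrary: q rule: rev_induct)
  case Nil
  have "steps (detector S) (estimate S []) [] (estimate S [])"
    by (simp add: steps_Nil_iff detector_states_def)
  with Nil show ?case
    unfolding reachable_def detector_sample_def by (intro bexI[of _ "estimate S []"] bexI[of _ "[]"]) auto
next
  case (snoc a \<sigma>)
  then obtain p where p: "detector_sample S \<sigma> p" "(p, a, q) \<in> delta (detector S)"
    using detector_sample_backtrack by (meson append_in_lists_conv listsE)
  show ?case
  proof (rule reachable_step)
    show "reachable (detector S) p" using snoc p(1) by simp
    show "(p, a, q) \<in> delta (detector S)" by (rule p(2))
  qed (use snoc.prems detector_sample_in_states in auto)
qed

text \<open>The sample can be made to contain a prescribed state, such as the one from which a
  silent loop is later entered.\<close>

lemma detector_sample_exists: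
  assumes "x \<in> estimate S \<sigma>" "card (estimate S \<sigma>) > 1"
  obtains q where "detector_sample S \<sigma> q" "x \<in> q" "card q > 1"
proof (cases "\<sigma> = []")
  case True
  then show ?thesis using that[of "estimate S \<sigma>"] assms by (auto simp: detector_sample_def)
next
  case False
  obtain q where "{x} \<subseteq> q" "q \<subseteq> estimate S \<sigma>" "card q = 2"
    using exists_subset_between[of "{x}" 2 "estimate S \<sigma>"] assms finite_estimate by auto
  then show ?thesis using that[of q] assms False by (auto simp: detector_sample_def)
qed

text \<open>The path is built from its end by iterated backtracking: a pair chosen early might die
  out although the estimate stays ambiguous.\<close>

lemma detector_sample_path:
  "detector_sample S (\<sigma> @ \<tau>) q \<Longrightarrow> \<tau> \<in> lists (outputs S) \<Longrightarrow>
    \<exists>qs. transition_sequence (detector S) qs \<tau> \<and>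
      (\<forall>i\<le>length \<tau>. detector_sample S (\<sigma> @ take i \<tau>) (qs ! i))"
proof (induction \<tau> arbitrary: \<sigma>)
  case Nil
  then show ?case
    by (intro exI[of _ "[q]"]) (auto simp: transition_sequence_def intro: detector_sample_in_states)
next
  case (Cons a \<tau>)
  then obtain qs where qs: "transition_sequence (detector S) qs \<tau>"
    "\<And>i. i \<le> length \<tau> \<Longrightarrow> detector_sample S (\<sigma> @ a # take i \<tau>) (qs ! i)"
    using Cons.IH[of "\<sigma> @ [a]"] by auto
  obtain p where p: "detector_sample S \<sigma> p" "(p, a, qs ! 0) \<in> delta (detector S)"
    using detector_sample_backtrack[of \<sigma> a "qs ! 0"] qs(2)[of 0] Cons.prems(2) by auto
  have "transition_sequence (detector S) (p # qs) (a # \<tau>)"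
    using qs(1) p detector_sample_in_states[OF p(1)]
    unfolding transition_sequence_def by (auto simp: nth_Cons split: nat.splits)
  moreover have "detector_sample S (\<sigma> @ take i (a # \<tau>)) ((p # qs) ! i)"
    if "i \<le> length (a # \<tau>)" for i
    using that qs(2) p(1) by (cases i) auto
  ultimately show ?case by blast
qed

text \<open>A path of samples along \<open>\<tau>\<close> visits more pairs than exist, so by the
  pigeonhole principle one recurs and the segment between is a cycle.\<close>

lemma long_ambiguity_yields_cycle:
  assumes outputs: "\<sigma> \<in> lists (outputs S)" "\<tau> \<in> lists (outputs S)"
    and ambiguous: "\<And>i. i \<le> length \<tau> \<Longrightarrow> card (estimate S (\<sigma> @ take i \<tau>)) > 1"
    and long: "length \<tau> > card {q. q \<subseteq> states S \<and> card q = 2}"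
  shows "\<exists>qs es. reachable_cycle (detector S) qs es \<and> (\<forall>q\<in>set qs. card q = 2)"
proof -
  let ?P = "{q. q \<subseteq> states S \<and> card q = 2}"
  have "card (estimate S (\<sigma> @ \<tau>)) > 1" using ambiguous[of "length \<tau>"] by simp
  moreover from this have "estimate S (\<sigma> @ \<tau>) \<noteq> {}" by force
  ultimately obtain q where "detector_sample S (\<sigma> @ \<tau>) q"
    using detector_sample_exists by (meson ex_in_conv)
  from detector_sample_path[OF this outputs(2)] obtain qs
    where path: "transition_sequence (detector S) qs \<tau>"
      and sample: "\<And>i. i \<le> length \<tau> \<Longrightarrow> detector_sample S (\<sigma> @ take i \<tau>) (qs ! i)"
    by blast
  have len: "length qs = Suc (length \<tau>)" using path by (simp add: transition_sequence_def)
  \<comment> \<open>Index 0 is left out: if \<open>\<sigma>\<close> is empty, \<open>qs ! 0\<close>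
    is the initial estimate, which may have more than two elements. The remaining
    \<open>length \<tau>\<close> positions still exceed the number of pairs.\<close>
  have two: "card (qs ! i) = 2" if "i \<in> {1..length \<tau>}" for i
    using sample[of i] ambiguous[of i] that by (auto simp: detector_sample_def split: if_splits)
  have "(!) qs ` {1..length \<tau>} \<subseteq> ?P"
    using two path detector_states_subset len unfolding transition_sequence_def
    by (auto simp: subset_iff) (metis One_nat_def Suc_le_lessD le_imp_less_Suc nth_mem)
  moreover have "finite ?P" using finite_states by simp
  ultimately have "card ((!) qs ` {1..length \<tau>}) < card {1..length \<tau>}"
    using long card_mono by (metis (no_types, lifting) card_atLeastAtMost diff_Suc_1 le_less_trans)
  then have "\<not> inj_on ((!) qs) {1..length \<tau>}" by (rule pigeonhole)
  then obtain i j where ij: "1 \<le> i" "i < j" "j \<le> length \<tau>" "qs ! i = qs ! j"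
    unfolding inj_on_def by (metis atLeastAtMost_iff linorder_neqE_nat)
  define ps where "ps = take (Suc (j - i)) (drop i qs)"
  define es where "es = take (j - i) (drop i \<tau>)"
  have nth_ps: "ps ! m = qs ! (i + m)" if "m \<le> j - i" for m
    using that ij len by (simp add: ps_def)
  have len_ps: "length ps = Suc (j - i)" using ij len by (simp add: ps_def)
  have mem_ps: "\<exists>m\<in>{1..length \<tau>}. p = qs ! m" if "p \<in> set ps" for p
  proof -
    obtain m where "m < length ps" "p = ps ! m"
      using \<open>p \<in> set ps\<close> by (auto simp: in_set_conv_nth)
    then show ?thesis using nth_ps[of m] len_ps ij by (intro bexI[of _ "i + m"]) auto
  qed
  have "transition_sequence (detector S) ps es"
    unfolding ps_def es_def using path ij by (intro transition_sequence_infix) auto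
  moreover have "es \<noteq> []" using ij by (simp add: es_def)
  moreover have "hd ps = last ps"
  proof -
    have "ps \<noteq> []" using len_ps by auto
    then show ?thesis
      using nth_ps[of 0] nth_ps[of "j - i"] len_ps ij by (simp add: hd_conv_nth last_conv_nth)
  qed
  moreover have "reachable (detector S) p" if "p \<in> set ps" for p
  proof -
    obtain m where "m \<in> {1..length \<tau>}" "p = qs ! m" using mem_ps[OF \<open>p \<in> set ps\<close>] by blast
    then show ?thesis
      using detector_sample_reachable[OF sample[of m]] outputs by (auto dest: in_set_takeD)
  qed
  moreover have "\<forall>p\<in>set ps. card p = 2" using mem_ps two by blast
  ultimately show ?thesis
    unfolding reachable_cycle_def transition_cycle_def by blast
qed

section \<open>Lasso-shaped words\<close>

lemma lasso_in_omega_language: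
  assumes "x0 \<in> init S" "steps S x0 u x" "steps S x v x" "v \<noteq> []"
  shows "u @- cycle v \<in> omega_language S"
proof -
  let ?s = "u @- cycle v"
  \<comment> \<open>Invariant for choosing the run state by state: the current state can still reach
    \<open>x\<close> by a word \<open>w\<close>, and the remaining input is \<open>w\<close>
    followed by the loop.\<close>
  let ?P = "\<lambda>n y. (n = 0 \<longrightarrow> y = x0) \<and> (\<exists>w. steps S y w x \<and> sdrop n ?s = w @- cycle v)"
  have "\<exists>f. \<forall>n. ?P n (f n) \<and> (f n, ?s !! n, f (Suc n)) \<in> delta S"
  proof (rule dependent_nat_choice)
    show "\<exists>y. ?P 0 y" using assms(2) by auto
  next
    fix y n assume "?P n y"
    then obtain w where w: "steps S y w x" "sdrop n ?s = w @- cycle v" by blast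
    \<comment> \<open>If \<open>w\<close> is used up, the run is at \<open>x\<close>, and unrolling
      one more copy of the nonempty \<open>v\<close> supplies the next event.\<close>
    obtain t w' where w': "steps S y (t # w') x" "sdrop n ?s = (t # w') @- cycle v"
    proof (cases w)
      case Nil
      then have "y = x" using w(1) by (simp add: steps_Nil_iff)
      then show ?thesis
        using that assms(3,4) Nil w(2) cycle_decomp[of v] by (cases v) auto
    qed (use w that in blast)
    have "?s !! n = t" using w'(2) by (metis append_Cons sdrop_simps(1) shift_simps(1) list.sel(1) list.distinct(1))
    moreover have "sdrop (Suc n) ?s = w' @- cycle v"
      using w'(2) by (metis sdrop_simps(2) sdrop_stl shift.simps(2) stream.sel(2))
    ultimately show "\<exists>z. ?P (Suc n) z \<and> (y, ?s !! n, z) \<in> delta S"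
      using w'(1) by (auto simp: steps_Cons_iff)
  qed
  then obtain f where f0: "f 0 = x0" and f: "\<And>n. (f n, ?s !! n, f (Suc n)) \<in> delta S"
    by blast
  have "?s \<in> streams (events S)"
    using f delta_subset by (auto simp: streams_iff_snth)
  moreover have "smap f nats \<in> streams (states S)"
    using f delta_subset by (auto simp: streams_iff_snth)
  ultimately show ?thesis
    unfolding omega_language_def using assms(1) f f0
    by (auto intro!: bexI[of _ "smap f nats"])
qed

text \<open>The one prefix \<open>u\<close> defeats every bound \<open>k\<close> at once, since no
  continuation along the loop ever has a singleton estimate.\<close>

lemma ambiguous_lasso_not_detectable:
  assumes "x0 \<in> init S" "steps S x0 u x" "steps S x v x" "v \<noteq> []"
    and ambiguous: "\<And>w w' n. w @ w' = concat (replicate n v) \<Longrightarrow>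
      card (estimate S (label_word S (u @ w))) > 1"
  shows "\<not> strongly_periodically_detectable S"
proof
  assume "strongly_periodically_detectable S"
  moreover have "u @- cycle v \<in> omega_language S" by (rule lasso_in_omega_language) fact+
  moreover have "finite_prefix u (u @- cycle v)" unfolding finite_prefix_def by blast
  ultimately obtain w where w: "finite_prefix (u @ w) (u @- cycle v)"
      "card (estimate S (label_word S (u @ w))) = 1"
    unfolding strongly_periodically_detectable_def by blast
  then obtain r where "w @- r = cycle v" unfolding finite_prefix_def by auto
  with \<open>v \<noteq> []\<close> obtain w' n where "w @ w' = concat (replicate n v)"
    using prefix_of_cycle by blast
  then show False using ambiguous w(2) by fastforce
qed

text \<open>Going silently from \<open>x\<close> to the loop and round it adds no label, so the
  estimate stays the one that contains \<open>q\<close>.\<close>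

lemma unobservable_cycle_not_detectable:
  assumes "reachable (detector S) q" "card q > 1" "x \<in> q"
    and "s1 \<in> lists (unobservable S)" "s2 \<in> lists (unobservable S)" "s2 \<noteq> []"
    and "steps S x s1 y" "steps S y s2 y"
  shows "\<not> strongly_periodically_detectable S"
proof -
  obtain \<sigma> where \<sigma>: "q \<subseteq> estimate S \<sigma>" using detector_reachable_subset assms(1) .
  then obtain x0 u where u: "x0 \<in> init S" "label_word S u = \<sigma>" "steps S x0 u x"
    using assms(3) mem_estimate_iff by blast
  have lab: "label_word S s1 = []" "label_word S s2 = []"
    using assms(4,5) unobservable_word_iff by auto
  show ?thesis
  proof (rule ambiguous_lasso_not_detectable)
    show "steps S x0 (u @ s1) y" using u(3) assms(7) by (rule steps_append)
    fix w w' n assume "w @ w' = concat (replicate n s2)"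
    moreover have "label_word S (concat (replicate n s2)) = []"
      using lab(2) by (induction n) auto
    ultimately have "label_word S w = []" by (metis append_is_Nil_conv label_word_append)
    then show "card (estimate S (label_word S ((u @ s1) @ w))) > 1"
      using u(2) lab(1) assms(2) card_mono[OF finite_estimate \<sigma>] by simp
  qed (use u assms in auto)
qed

lemma detector_cycle_not_detectable:
  assumes cycle: "reachable_cycle (detector S) qs es" and two: "\<And>q. q \<in> set qs \<Longrightarrow> card q = 2"
  shows "\<not> strongly_periodically_detectable S"
proof -
  let ?q = "qs ! 0"
  have path: "transition_sequence (detector S) qs es" and "es \<noteq> []" and "hd qs = last qs"
    and reach: "\<And>q. q \<in> set qs \<Longrightarrow> reachable (detector S) q"
    using cycle by (auto simp: reachable_cycle_def transition_cycle_def)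
  have len: "length qs = Suc (length es)" using path by (simp add: transition_sequence_def)
  then have "qs \<noteq> []" by auto
  then have closed: "qs ! length es = ?q"
    using \<open>hd qs = last qs\<close> len by (simp add: hd_conv_nth last_conv_nth)
  have mem: "qs ! i \<in> set qs" if "i \<le> length es" for i using that len by simp
  have loop: "steps (detector S) ?q es ?q"
    using transition_sequence_steps[OF path, of "length es"] closed by simp

  \<comment> \<open>\<open>R\<close> records one turn of the detector cycle at the level of single
    states; a loop of the automaton is a closed chain of \<open>R\<close>.\<close>
  define R where "R = {(x, y). x \<in> ?q \<and> y \<in> ?q \<and> (\<exists>v. steps S x v y \<and> label_word S v = es)}"
  have card_q: "card ?q = 2" using two mem[of 0] by simp
  then have "finite ?q" "?q \<noteq> {}" by (auto intro: card_ge_0_finite)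
  \<comment> \<open>A finite acyclic relation is well-founded, so \<open>?q\<close> would have a
    minimal element; but lifting the cycle backwards gives every element of \<open>?q\<close> a
    predecessor in \<open>?q\<close>.\<close>
  have "\<not> acyclic R"
  proof
    assume "acyclic R"
    moreover have "finite R"
      by (rule finite_subset[of _ "?q \<times> ?q"]) (auto simp: R_def \<open>finite ?q\<close>)
    ultimately have "wf R" by (rule finite_acyclic_wf[rotated])
    moreover obtain y0 where "y0 \<in> ?q" using \<open>?q \<noteq> {}\<close> by blast
    ultimately obtain y where "y \<in> ?q" "\<And>x. (x, y) \<in> R \<Longrightarrow> x \<notin> ?q"
      by (rule wfE_min) blast
    moreover have "\<exists>x\<in>?q. (x, y) \<in> R"
      using detector_steps_lift[OF loop \<open>y \<in> ?q\<close>] \<open>y \<in> ?q\<close> unfolding R_def by blast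
    ultimately show False by blast
  qed
  then obtain x where x: "(x, x) \<in> R\<^sup>+" unfolding acyclic_def by blast
  \<comment> \<open>Chaining turns concatenates their labels. The exponent \<open>Suc n\<close> is
    positive, which later makes the loop \<open>v\<close> nonempty.\<close>
  have "\<exists>n v. steps S y v z \<and> label_word S v = concat (replicate (Suc n) es)"
    if "(y, z) \<in> R\<^sup>+" for y z
    using that
  proof (induction rule: trancl_induct)
    case (base z)
    then show ?case unfolding R_def by (auto intro!: exI[of _ "0::nat"])
  next
    case (step z z')
    then obtain n v v' where "steps S y v z" "label_word S v = concat (replicate (Suc n) es)"
      "steps S z v' z'" "label_word S v' = es"
      unfolding R_def by blast
    then have "steps S y (v @ v') z'"
      "label_word S (v @ v') = concat (replicate (Suc (Suc n)) es)"
      using concat_replicate_snoc[of "Suc n" es] by (auto intro: steps_append)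
    then show ?case by blast
  qed
  with x obtain m v where v: "steps S x v x" "label_word S v = concat (replicate (Suc m) es)"
    by blast
  have "v \<noteq> []" using v(2) \<open>es \<noteq> []\<close> by auto
  have "x \<in> ?q" using x by (metis (no_types, lifting) R_def case_prodD mem_Collect_eq tranclD)

  obtain \<sigma> where \<sigma>: "?q \<subseteq> estimate S \<sigma>"
    using detector_reachable_subset reach[OF mem[of 0]] by blast
  then obtain x0 u where u: "x0 \<in> init S" "label_word S u = \<sigma>" "steps S x0 u x"
    using \<open>x \<in> ?q\<close> mem_estimate_iff by blast

  \<comment> \<open>Within the first turn, the estimate contains the cycle state at position
    \<open>length w\<close>. A longer \<open>w\<close> loses one full turn, which is absorbed into
    \<open>\<sigma>\<close>; hence the statement is general in \<open>\<sigma>\<close>.\<close>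
  have prefixes: "card (estimate S (\<sigma> @ w)) > 1"
    if "?q \<subseteq> estimate S \<sigma>" "w @ w' = concat (replicate n es)" for w w' n \<sigma>
    using that
  proof (induction n arbitrary: \<sigma> w)
    case 0
    then show ?case using card_mono[OF finite_estimate, of ?q \<sigma>] card_q by simp
  next
    case (Suc n)
    then have eq: "w @ w' = es @ concat (replicate n es)" by simp
    show ?case
    proof (cases "length w \<le> length es")
      case True
      then have "w = take (length w) es" using eq by (metis append_eq_append_conv_if append_eq_conv_conj)
      then have "qs ! length w \<subseteq> estimate S (\<sigma> @ w)"
        using detector_steps_subset[OF transition_sequence_steps[OF path True] Suc.prems(1)] by simp
      from card_mono[OF finite_estimate this] show ?thesis
        using two[OF mem[OF True]] by simp
    next
      case False
      then obtain w1 where w1: "w = es @ w1" "w1 @ w' = concat (replicate n es)"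
        using eq unfolding append_eq_append_conv2 by auto
      have "?q \<subseteq> estimate S (\<sigma> @ es)" using detector_steps_subset[OF loop Suc.prems(1)] .
      from Suc.IH[OF this w1(2)] show ?thesis using w1(1) by simp
    qed
  qed
  show ?thesis
  proof (rule ambiguous_lasso_not_detectable)
    fix w w' n assume "w @ w' = concat (replicate n v)"
    then have "label_word S w @ label_word S w' = label_word S (concat (replicate n v))"
      by (metis label_word_append)
    also have "\<dots> = concat (replicate (n * Suc m) es)"
      using v(2) by (induction n) (simp_all add: replicate_add del: mult_Suc_right)
    finally show "card (estimate S (label_word S (u @ w))) > 1"
      using prefixes[OF \<sigma>] u(2) by simp
  qed (use u v \<open>v \<noteq> []\<close> in auto)
qed

section \<open>Undetectable words\<close>

lemma not_detectable_dichotomy: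
  assumes "\<not> strongly_periodically_detectable S"
  shows "(\<exists>q\<in>detector_states S. reachable (detector S) q \<and> card q > 1 \<and>
       (\<exists>x\<in>q. \<exists>s1\<in>lists (unobservable S). \<exists>s2\<in>lists (unobservable S) - {[]}.
          \<exists>y\<in>states S. steps S x s1 y \<and> steps S y s2 y))
    \<or> (\<exists>qs es. reachable_cycle (detector S) qs es \<and> (\<forall>q\<in>set qs. card q = 2))"
proof -
  \<comment> \<open>With \<open>+ 2\<close>, a label word of length \<open>k - 1\<close> is still
    below the bound and yet longer than the number of pairs.\<close>
  define k where "k = card {q. q \<subseteq> states S \<and> card q = 2} + 2"
  have "k > 0" by (simp add: k_def)
  then obtain s s' where s: "s \<in> omega_language S" "finite_prefix s' s"
    and ambiguous': "\<And>w. w \<in> lists (events S) \<Longrightarrow> length (label_word S w) < k \<Longrightarrow>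
      finite_prefix (s' @ w) s \<Longrightarrow> card (estimate S (label_word S (s' @ w))) \<noteq> 1"
    using assms unfolding strongly_periodically_detectable_def by blast
  obtain r where r: "s = s' @- r" using s(2) by (auto simp: finite_prefix_def)
  obtain xs where xs: "shd xs \<in> init S" "\<And>i. (xs !! i, s !! i, xs !! Suc i) \<in> delta S"
    using s(1) by (auto simp: omega_language_def)
  have states: "xs !! i \<in> states S" for i using xs(2)[of i] delta_subset by blast
  have run: "steps S (xs !! i) (stake j (sdrop i s)) (xs !! (i + j))" for i j
  proof (induction j arbitrary: i)
    case 0
    then show ?case using states by (simp add: steps_Nil_iff)
  next
    case (Suc j)
    have "sdrop i s = s !! i ## sdrop (Suc i) s" by (metis sdrop_simps stream.collapse)
    then show ?case using Suc[of "Suc i"] xs(2)[of i] by (auto simp: steps_Cons_iff)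
  qed
  define n where "n = length s'"
  have r_drop: "r = sdrop n s" using r by (simp add: n_def sdrop_shift)
  define y where "y j = xs !! (n + j)" for j
  have steps_y: "steps S (y i) (stake j (sdrop i r)) (y (i + j))" for i j
    using run[of "n + i" j] by (simp add: y_def r_drop add.assoc)
  have "steps S (xs !! 0) s' (y 0)"
    using run[of 0 n] r by (simp add: y_def n_def stake_shift)
  then have prefix: "steps S (xs !! 0) (s' @ stake j r) (y j)" for j
    using steps_y[of 0 j] by (auto intro: steps_append)
  define lab where "lab j = label_word S (stake j r)" for j
  define \<sigma> where "\<sigma> = label_word S s'"
  have in_estimate: "y j \<in> estimate S (\<sigma> @ lab j)" for j
    unfolding mem_estimate_iff using xs(1) prefix[of j]
    by (intro bexI[of _ "xs !! 0"] exI[of _ "s' @ stake j r"]) (auto simp: \<sigma>_def lab_def)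
  \<comment> \<open>The run itself puts \<open>y j\<close> into the estimate, so a cardinality
    different from 1 must exceed 1.\<close>
  have ambiguous: "card (estimate S (\<sigma> @ lab j)) > 1" if "length (lab j) < k" for j
  proof -
    have "finite_prefix (s' @ stake j r) s"
      unfolding finite_prefix_def using r stake_sdrop[of j r] by (intro exI[of _ "sdrop j r"]) simp
    then have "card (estimate S (\<sigma> @ lab j)) \<noteq> 1"
      using ambiguous'[of "stake j r"] steps_events[OF steps_y[of 0 j]] that
      by (simp add: \<sigma>_def lab_def)
    moreover have "card (estimate S (\<sigma> @ lab j)) \<noteq> 0"
      using in_estimate finite_estimate by auto
    ultimately show ?thesis by linarith
  qed
  have outputs: "\<sigma> \<in> lists (outputs S)" "lab j \<in> lists (outputs S)" for j
    using label_word_outputs steps_events[OF prefix[of j]]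
    unfolding \<sigma>_def lab_def by auto
  have lab_add: "lab (i + j) = lab i @ label_word S (stake j (sdrop i r))" for i j
    unfolding lab_def by (metis label_word_append stake_add)
  show ?thesis
  proof (cases "\<forall>j. length (lab j) < k")
    case True
    \<comment> \<open>The label lengths are bounded, so some \<open>j0\<close> attains the maximum,
      and every event of \<open>r\<close> after the first \<open>j0\<close> is unobservable.\<close>
    let ?L = "range (\<lambda>j. length (lab j))"
    from True have "finite ?L"
      by (auto intro: finite_subset[of _ "{..<k}"])
    then have "Max ?L \<in> ?L" by (intro Max_in) auto
    then obtain j0 where "Max ?L = length (lab j0)" by blast
    then have j0: "length (lab j) \<le> length (lab j0)" for j
      using Max_ge[OF \<open>finite ?L\<close>, of "length (lab j)"] by simp
    have silent: "label_word S (stake j (sdrop (j0 + i) r)) = []" for i j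
      using j0[of "j0 + (i + j)"] lab_add[of j0 i] lab_add[of "j0 + i" j] by (simp add: add.assoc)
    obtain q where q: "detector_sample S (\<sigma> @ lab j0) q" "y j0 \<in> q" "card q > 1"
      using detector_sample_exists[OF in_estimate ambiguous] True by blast
    \<comment> \<open>The infinite silent rest of the run visits finitely many states; a repetition
      splits it into the approach \<open>?s1\<close> and the loop \<open>?s2\<close>.\<close>
    have "\<not> inj (\<lambda>i. y (j0 + i))"
      using finite_states states infinite_UNIV_nat unfolding y_def
      by (metis (no_types, lifting) finite_imageD finite_subset image_subsetI)
    then obtain i i' where ii: "i < i'" "y (j0 + i) = y (j0 + i')"
      unfolding inj_on_def by (metis linorder_neqE_nat)
    let ?s1 = "stake i (sdrop j0 r)" and ?s2 = "stake (i' - i) (sdrop (j0 + i) r)"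
    have s1: "steps S (y j0) ?s1 (y (j0 + i))" by (rule steps_y)
    have s2: "steps S (y (j0 + i)) ?s2 (y (j0 + i))"
      using steps_y[of "j0 + i" "i' - i"] ii by simp
    have "?s1 \<in> lists (unobservable S)" "?s2 \<in> lists (unobservable S) - {[]}"
      using steps_events[OF s1] steps_events[OF s2] silent[of i 0] silent[of "i' - i" i] ii
      unfolding unobservable_word_iff Diff_iff
      by (auto simp del: in_lists_conv_set)
    moreover have "reachable (detector S) q"
      using detector_sample_reachable[OF q(1)] outputs by simp
    ultimately show ?thesis
      using q s1 s2 detector_sample_in_states[OF q(1)] steps_target_in_states[OF s1] by blast
  next
    case False
    define j where "j = (LEAST j. length (lab j) \<ge> k)"
    \<comment> \<open>\<open>\<tau>\<close> consists of the first \<open>k - 1\<close> labels after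
      \<open>s'\<close>, so all its prefixes have length below \<open>k\<close>.\<close>
    obtain \<tau> \<rho> where \<tau>: "lab j = \<tau> @ \<rho>" "length \<tau> = k - 1" "\<rho> \<noteq> []"
    proof -
      have "length (lab j) \<ge> k" unfolding j_def using False by (metis LeastI not_le)
      then show ?thesis
        using that[of "take (k - 1) (lab j)" "drop (k - 1) (lab j)"] \<open>k > 0\<close> by auto
    qed
    have "card (estimate S (\<sigma> @ take i \<tau>)) > 1" if "i \<le> length \<tau>" for i
    proof -
      have "label_word S (stake j r) = take i \<tau> @ drop i \<tau> @ \<rho>"
        using \<tau>(1) by (simp add: lab_def)
      \<comment> \<open>Ambiguity is known only at prefixes of \<open>r\<close>, so each prefix of
        \<open>\<tau>\<close> is realized as the label word of such a prefix.\<close>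
      then obtain u1 u2 where u: "stake j r = u1 @ u2" "label_word S u1 = take i \<tau>"
        by (rule label_word_eq_appendE)
      have "u1 = stake (length u1) r"
        using u(1) by (metis append_eq_conv_conj length_append length_stake le_add1 take_stake min.absorb1)
      then have "lab (length u1) = take i \<tau>" using u(2) by (simp add: lab_def)
      then show ?thesis
        using ambiguous[of "length u1"] \<tau>(2) that \<open>k > 0\<close> by simp
    qed
    moreover have "\<tau> \<in> lists (outputs S)" using outputs(2)[of j] \<tau>(1) by simp
    moreover have "length \<tau> > card {q. q \<subseteq> states S \<and> card q = 2}" using \<tau>(2) by (simp add: k_def)
    ultimately show ?thesis using long_ambiguity_yields_cycle outputs(1) by blast
  qed
qed

end

theorem theorem4p6:
  fixes S :: "('x, 't, 'a) fsa"
  assumes "finite_state_automaton S"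
  shows "\<not> strongly_periodically_detectable S \<longleftrightarrow>
    (\<exists>q'\<in>states (detector S). reachable (detector S) q' \<and> card q' > 1 \<and>
       (\<exists>x\<in>q'. \<exists>s1\<in>lists (unobservable S). \<exists>s2\<in>lists (unobservable S) - {[]}.
          \<exists>x'\<in>states S. steps S x s1 x' \<and> steps S x' s2 x'))
    \<or> (\<exists>qs es. reachable_cycle (detector S) qs es \<and> (\<forall>q\<in>set qs. card q = 2))"
proof -
  interpret finite_state_automaton S by (rule assms)
  show ?thesis
    using not_detectable_dichotomy unobservable_cycle_not_detectable detector_cycle_not_detectable
    unfolding detector_simps by blast
qed

end
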